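(* Let $(A,\mu,\alpha)$ be a regular Hom-associative algebra over $\mathbb{K}$ (that is, $\alpha$ is invertible), let $(M,l,r,\phi)$ be an $A$-bimodule with $\phi$ invertible, and let $T:M\to A$ be an $\mathcal{O}$-operator on $A$ with respect to the $A$-bimodule $M$. Then the two coboundary operators $d_T=\llbracket T,\ \cdot\ \rrbracket_\alpha$ and $d_H$ on $C^\bullet_\alpha(M,A)=\bigoplus_{n\ge0}C^n_\alpha(M,A)$ are related by $$d_Tf=(-1)^n\,d_Hf,\qquad f\in C^n_\alpha(M,A).$$
   Context: A Hom-associative algebra $(A,\mu,\alpha)$ (always multiplicative) is a $\mathbb{K}$-vector space $A$ with a bilinear map $\mu$, written $\mu(a,b)=a\cdot b$, and a linear map $\alpha:A\to A$ such that $\alpha(a\cdot b)=\alpha(a)\cdot\alpha(b)$ and $\alpha(a)\cdot(b\cdot c)=(a\cdot b)\cdot\alpha(c)$ for all $a,b,c\in A$. A bimodule $(M,l,r,\phi)$ over $(A,\mu,\alpha)$ is a vector space $M$ with linear maps $\phi:M\to M$, $l:A\otimes M\to M$, $r:M\otimes A\to M$ such that for all $x,y\in A$, $v\in M$: $\phi l(x,v)=l(\alpha(x),\phi(v))$, $\phi r(v,x)=r(\phi(v),\alpha(x))$, $l(x\cdot y,\phi(v))=l(\alpha(x),l(y,v))$, $r(\phi(v),x\cdot y)=r(r(v,x),\alpha(y))$, $l(\alpha(x),r(v,y))=r(l(x,v),\alpha(y))$. An $\mathcal{O}$-operator on $A$ with respect to $M$ is a linear map $T:M\to A$ with $T\phi=\alpha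 T$ and $T(u)\cdot T(v)=T(l(T(u),v)+r(u,T(v)))$ for all $u,v\in M$. It makes $(M,\star_T,\phi)$ a Hom-associative algebra with $u\star_Tv=r(u,T(v))+l(T(u),v)$, and $A$ an $M$-bimodule (with respect to $\alpha$) via $l_T(u,x)=T(u)\cdot x-T(r(u,x))$, $r_T(x,u)=x\cdot T(u)-T(l(x,u))$. Cochains: $C^n_\alpha(M,A)=\mathrm{Hom}(M^{\otimes n},A)$ for all $n\ge0$, so $C^0_\alpha(M,A)=A$. Differential $d_H$ (the Hochschild differential of $(M,\star_T,\phi)$ with coefficients in $(A,l_T,r_T,\alpha)$): for $a\in A=C^0_\alpha(M,A)$ and $u\in M$, $$d_H(a)(u)=l_T(u,a)-r_T(a,u)=T(u)\cdot a-T(r(u,a))-a\cdot T(u)+T(l(a,u)),$$ and for $n\ge1$, $f\in C^n_\alpha(M,A)$, $$(d_Hf)(u_1,\dots,u_{n+1})=T(\phi^{n-1}(u_1))\cdot f(u_2,\dots,u_{n+1})-T(r(\phi^{n-1}(u_1),f(u_2,\dots,u_{n+1})))$$ $$+\sum_{i=1}^n(-1)^if(\phi(u_1),\dots,\phi(u_{i-1}),\,r(u_i,T(u_{i+1}))+l(T(u_i),u_{i+1}),\,\phi(u_{i+2}),\dots,\phi(u_{n+1}))$$ $$+(-1)^{n+1}f(u_1,\dots,u_n)\cdot T(\phi^{n-1}(u_{n+1}))-(-1)^{n+1}T(l(f(u_1,\dots,u_n),\phi^{n-1}(u_{n+1}))).$$ Ambient bracket: put $V=A\oplus M$ and $\gamma=\alpha+\phi:V\to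 V$, $(x,u)\mapsto(\alpha(x),\phi(u))$. For linear maps $f:V^{\otimes m}\to V$, $g:V^{\otimes n}\to V$ set $[f,g]_\alpha=f\circ g-(-1)^{(m-1)(n-1)}g\circ f$, where $$(f\circ g)(v_1,\dots,v_{m+n-1})=\sum_{i=1}^m(-1)^{(i-1)(n-1)}f(\gamma^{n-1}(v_1),\dots,\gamma^{n-1}(v_{i-1}),g(v_i,\dots,v_{i+n-1}),\gamma^{n-1}(v_{i+n}),\dots,\gamma^{n-1}(v_{m+n-1})).$$ The maps $\mu,l,r$ and each $P\in\mathrm{Hom}(M^{\otimes n},A)$, $n\ge1$, are regarded as multilinear maps on $V$ with values in $V$, extended by zero on the other components. Bracket $\llbracket\ ,\ \rrbracket_\alpha$: for $P\in\mathrm{Hom}(M^{\otimes m},A)$, $Q\in\mathrm{Hom}(M^{\otimes n},A)$ with $m,n\ge1$, $\llbracket P,Q\rrbracket_\alpha=(-1)^m[[\mu+l+r,P]_\alpha,Q]_\alpha$. For $P\in\mathrm{Hom}(M^{\otimes m},A)$, $m\ge1$, and $a\in A$, $$\llbracket P,a\rrbracket_\alpha(u_1,\dots,u_m)=\sum_{i=1}^mP(\phi^m(u_1),\dots,\phi^m(u_{i-1}),\,l(a,\phi^{m-1}(u_i))-r(\phi^{m-1}(u_i),a),\,\phi^m(u_{i+1}),\dots,\phi^m(u_m))$$ $$+\mu(P(\phi^{-1}(u_1),\dots,\phi^{-1}(u_m)),a)-\mu(a,P(\phi^{-1}(u_1),\dots,\phi^{-1}(u_m))).$$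
   Formalization: In the bracket of P with an element a of A, the last two terms use P(φ^{m-1}(u_1),…,φ^{m-1}(u_m)) in place of P(φ^{-1}(u_1),…,φ^{-1}(u_m)); with φ^{-1} the claim fails for n = 0. *)

theory Defs
  imports Complex_Main "HOL-Library.Product_Plus"
begin

text \<open>
  Vector spaces are whole types with an explicit scalar multiplication by a field \<open>'k\<close>.
  Tensors \<open>v\<^sub>1 \<otimes> \<dots> \<otimes> v\<^sub>n\<close> are fed to multilinear maps as lists of length \<open>n\<close>, so a map in
  \<open>Hom(V\<^sup>\<otimes>\<^sup>n, W)\<close> is a function on lists of which only the values on lists of length \<open>n\<close> matter;
  the arity is always passed separately. An element \<open>a\<close> of \<open>Hom(V\<^sup>\<otimes>\<^sup>0, W) = W\<close> is
  represented by a function with value \<open>a\<close> on the empty list.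
\<close>

locale hom_assoc_algebra =
  fixes sA :: "'k::field \<Rightarrow> 'a::ab_group_add \<Rightarrow> 'a"
    and mu :: "'a \<Rightarrow> 'a \<Rightarrow> 'a"
    and alpha :: "'a \<Rightarrow> 'a"
  assumes vector_space_A: "vector_space sA"
    and mu_linear_right: "Vector_Spaces.linear sA sA (mu a)"
    and mu_linear_left: "Vector_Spaces.linear sA sA (\<lambda>a. mu a b)"
    and alpha_linear: "Vector_Spaces.linear sA sA alpha"
    and alpha_mult: "alpha (mu a b) = mu (alpha a) (alpha b)"
    and hom_assoc: "mu (alpha a) (mu b c) = mu (mu a b) (alpha c)"

locale regular_hom_assoc_algebra = hom_assoc_algebra +
  assumes alpha_bij: "bij alpha"

locale hom_bimodule = hom_assoc_algebra sA mu alpha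
  for sA :: "'k::field \<Rightarrow> 'a::ab_group_add \<Rightarrow> 'a" and mu alpha +
  fixes sM :: "'k \<Rightarrow> 'm::ab_group_add \<Rightarrow> 'm"
    and l :: "'a \<Rightarrow> 'm \<Rightarrow> 'm"
    and r :: "'m \<Rightarrow> 'a \<Rightarrow> 'm"
    and phi :: "'m \<Rightarrow> 'm"
  assumes vector_space_M: "vector_space sM"
    and phi_linear: "Vector_Spaces.linear sM sM phi"
    and l_linear_right: "Vector_Spaces.linear sM sM (l x)"
    and l_linear_left: "Vector_Spaces.linear sA sM (\<lambda>x. l x v)"
    and r_linear_right: "Vector_Spaces.linear sA sM (r v)"
    and r_linear_left: "Vector_Spaces.linear sM sM (\<lambda>v. r v x)"
    and phi_l: "phi (l x v) = l (alpha x) (phi v)"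
    and phi_r: "phi (r v x) = r (phi v) (alpha x)"
    and l_mult: "l (mu x y) (phi v) = l (alpha x) (l y v)"
    and r_mult: "r (phi v) (mu x y) = r (r v x) (alpha y)"
    and l_r: "l (alpha x) (r v y) = r (l x v) (alpha y)"

locale O_operator = hom_bimodule sA mu alpha sM l r phi
  for sA :: "'k::field \<Rightarrow> 'a::ab_group_add \<Rightarrow> 'a" and mu alpha
    and sM :: "'k \<Rightarrow> 'm::ab_group_add \<Rightarrow> 'm" and l r phi +
  fixes T :: "'m \<Rightarrow> 'a"
  assumes T_linear: "Vector_Spaces.linear sM sA T"
    and T_phi: "T (phi v) = alpha (T v)"
    and T_mult: "mu (T u) (T v) = T (l (T u) v + r u (T v))"

definition Hom_tensor ::
    "('k::field \<Rightarrow> 'v::ab_group_add \<Rightarrow> 'v) \<Rightarrow> ('k \<Rightarrow> 'w::ab_group_add \<Rightarrow> 'w) \<Rightarrow> nat \<Rightarrow> ('v list \<Rightarrow> 'w) set"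
  where "Hom_tensor sV sW n =
    {f. \<forall>vs i. length vs = n \<longrightarrow> i < n \<longrightarrow> Vector_Spaces.linear sV sW (\<lambda>x. f (vs[i := x]))}"

definition star_T :: "('a \<Rightarrow> 'm::ab_group_add \<Rightarrow> 'm) \<Rightarrow> ('m \<Rightarrow> 'a \<Rightarrow> 'm) \<Rightarrow> ('m \<Rightarrow> 'a) \<Rightarrow> 'm \<Rightarrow> 'm \<Rightarrow> 'm"
  where "star_T l r T u v = r u (T v) + l (T u) v"

definition l_T :: "('a::ab_group_add \<Rightarrow> 'a \<Rightarrow> 'a) \<Rightarrow> ('m \<Rightarrow> 'a \<Rightarrow> 'm) \<Rightarrow> ('m \<Rightarrow> 'a) \<Rightarrow> 'm \<Rightarrow> 'a \<Rightarrow> 'a"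
  where "l_T mu r T u x = mu (T u) x - T (r u x)"

definition r_T :: "('a::ab_group_add \<Rightarrow> 'a \<Rightarrow> 'a) \<Rightarrow> ('a \<Rightarrow> 'm \<Rightarrow> 'm) \<Rightarrow> ('m \<Rightarrow> 'a) \<Rightarrow> 'a \<Rightarrow> 'm \<Rightarrow> 'a"
  where "r_T mu l T x u = mu x (T u) - T (l x u)"

text \<open>
  Hochschild differential, on \<open>n\<close>-cochains, of a Hom-associative algebra \<open>(B, star, phi)\<close> with
  coefficients in a bimodule \<open>W\<close> with scalar multiplication \<open>sW\<close> and actions \<open>lB\<close>, \<open>rB\<close>. The \<open>i\<close>-th
  argument \<open>u\<^sub>i\<close> is \<open>us ! (i - 1)\<close>.
\<close>
definition hochschild_d ::
    "('k::field \<Rightarrow> 'w::ab_group_add \<Rightarrow> 'w) \<Rightarrow> ('b \<Rightarrow> 'b \<Rightarrow> 'b) \<Rightarrow> ('b \<Rightarrow> 'b) \<Rightarrow> ('b \<Rightarrow> 'w \<Rightarrow> 'w) \<Rightarrow> ('w \<Rightarrow> 'b \<Rightarrow> 'w) \<Rightarrow>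
     nat \<Rightarrow> ('b list \<Rightarrow> 'w) \<Rightarrow> 'b list \<Rightarrow> 'w"
  where "hochschild_d sW star phi lB rB n f us =
    (if n = 0 then lB (us ! 0) (f []) - rB (f []) (us ! 0)
     else lB ((phi ^^ (n - 1)) (us ! 0)) (f (tl us))
        + (\<Sum>i=1..n. sW ((- 1) ^ i)
             (f (map phi (take (i - 1) us) @ [star (us ! (i - 1)) (us ! i)] @ map phi (drop (i + 1) us))))
        + sW ((- 1) ^ (n + 1)) (rB (f (take n us)) ((phi ^^ (n - 1)) (us ! n))))"

definition d_H ::
    "('k::field \<Rightarrow> 'a::ab_group_add \<Rightarrow> 'a) \<Rightarrow> ('a \<Rightarrow> 'a \<Rightarrow> 'a) \<Rightarrow> ('a \<Rightarrow> 'm::ab_group_add \<Rightarrow> 'm) \<Rightarrow> ('m \<Rightarrow> 'a \<Rightarrow> 'm) \<Rightarrow>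
     ('m \<Rightarrow> 'm) \<Rightarrow> ('m \<Rightarrow> 'a) \<Rightarrow> nat \<Rightarrow> ('m list \<Rightarrow> 'a) \<Rightarrow> 'm list \<Rightarrow> 'a"
  where "d_H sA mu l r phi T n f =
    hochschild_d sA (star_T l r T) phi (l_T mu r T) (r_T mu l T) n f"

text \<open>
  The operation \<open>f \<circ> g\<close> for \<open>f\<close> of arity \<open>m\<close> and \<open>g\<close> of arity \<open>n\<close> (both positive). The
  summation index is shifted by one: \<open>i\<close> is the number of arguments to the left of \<open>g\<close>.
\<close>
definition circ_prod ::
    "('k::field \<Rightarrow> 'v::ab_group_add \<Rightarrow> 'v) \<Rightarrow> ('v \<Rightarrow> 'v) \<Rightarrow> nat \<Rightarrow> nat \<Rightarrow>
     ('v list \<Rightarrow> 'v) \<Rightarrow> ('v list \<Rightarrow> 'v) \<Rightarrow> 'v list \<Rightarrow> 'v"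
  where "circ_prod sV gam m n f g vs =
    (\<Sum>i<m. sV ((- 1) ^ (i * (n - 1)))
       (f (map (gam ^^ (n - 1)) (take i vs) @ [g (take n (drop i vs))]
           @ map (gam ^^ (n - 1)) (drop (i + n) vs))))"

definition hom_bracket ::
    "('k::field \<Rightarrow> 'v::ab_group_add \<Rightarrow> 'v) \<Rightarrow> ('v \<Rightarrow> 'v) \<Rightarrow> nat \<Rightarrow> nat \<Rightarrow>
     ('v list \<Rightarrow> 'v) \<Rightarrow> ('v list \<Rightarrow> 'v) \<Rightarrow> 'v list \<Rightarrow> 'v"
  where "hom_bracket sV gam m n f g vs =
    circ_prod sV gam m n f g vs - sV ((- 1) ^ ((m - 1) * (n - 1))) (circ_prod sV gam n m g f vs)"

text \<open>
  Maps on \<open>V = A \<oplus> M\<close>: the extension by zero of a map in \<open>Hom(M\<^sup>\<otimes>\<^sup>n, A)\<close>, \<open>n \<ge> 1\<close>, and the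
  sum of the extensions by zero of \<open>mu\<close>, \<open>l\<close> and \<open>r\<close>.
\<close>
definition ext_AM :: "('m list \<Rightarrow> 'a) \<Rightarrow> ('a \<times> 'm::zero) list \<Rightarrow> 'a \<times> 'm"
  where "ext_AM P vs = (P (map snd vs), 0)"

definition mu_l_r ::
    "('a \<Rightarrow> 'a \<Rightarrow> 'a) \<Rightarrow> ('a \<Rightarrow> 'm::plus \<Rightarrow> 'm) \<Rightarrow> ('m \<Rightarrow> 'a \<Rightarrow> 'm) \<Rightarrow> ('a \<times> 'm) list \<Rightarrow> 'a \<times> 'm"
  where "mu_l_r mu l r vs =
    (mu (fst (vs ! 0)) (fst (vs ! 1)), l (fst (vs ! 0)) (snd (vs ! 1)) + r (snd (vs ! 0)) (fst (vs ! 1)))"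

text \<open>
  The derived bracket of \<open>P \<in> Hom(M\<^sup>\<otimes>\<^sup>m, A)\<close> and \<open>Q \<in> Hom(M\<^sup>\<otimes>\<^sup>n, A)\<close>, \<open>m, n \<ge> 1\<close>, kept as a
  map of arity \<open>m + n\<close> on all of \<open>V\<close>. The inner bracket has arity \<open>m + 1\<close>.
\<close>
definition derived_bracket ::
    "('k::field \<Rightarrow> 'a::ab_group_add \<Rightarrow> 'a) \<Rightarrow> ('a \<Rightarrow> 'a \<Rightarrow> 'a) \<Rightarrow> ('a \<Rightarrow> 'a) \<Rightarrow>
     ('k \<Rightarrow> 'm::ab_group_add \<Rightarrow> 'm) \<Rightarrow> ('a \<Rightarrow> 'm \<Rightarrow> 'm) \<Rightarrow> ('m \<Rightarrow> 'a \<Rightarrow> 'm) \<Rightarrow> ('m \<Rightarrow> 'm) \<Rightarrow>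
     nat \<Rightarrow> nat \<Rightarrow> ('m list \<Rightarrow> 'a) \<Rightarrow> ('m list \<Rightarrow> 'a) \<Rightarrow> ('a \<times> 'm) list \<Rightarrow> 'a \<times> 'm"
  where "derived_bracket sA mu alpha sM l r phi m n P Q vs =
    (let sV = (\<lambda>c. map_prod (sA c) (sM c)); gam = map_prod alpha phi in
     sV ((- 1) ^ m)
       (hom_bracket sV gam (m + 1) n (hom_bracket sV gam 2 m (mu_l_r mu l r) (ext_AM P)) (ext_AM Q) vs))"

text \<open>
  The bracket of \<open>P \<in> Hom(M\<^sup>\<otimes>\<^sup>m, A)\<close>, \<open>m \<ge> 1\<close>, with \<open>a \<in> A\<close>. In the last two terms \<open>P\<close> is evaluated
  at \<open>(phi\<^sup>m\<^sup>-\<^sup>1(u\<^sub>1), \<dots>, phi\<^sup>m\<^sup>-\<^sup>1(u\<^sub>m))\<close>; this is what the derived bracket gives for \<open>alpha(a) = a\<close>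
  (put \<open>n = 0\<close> in its formula and precompose with \<open>phi\<^sup>m\<close>), in line with the powers of \<open>phi\<close> in
  the first sum. The exponent is sometimes printed as \<open>-1\<close> in place of \<open>m - 1\<close>. For \<open>m = 1\<close> that
  would be \<open>mu(T(phi\<^sup>-\<^sup>1(u)), a) - mu(a, T(phi\<^sup>-\<^sup>1(u)))\<close>, which differs from the terms
  \<open>mu(T(u), a) - mu(a, T(u))\<close> of \<open>d_H(a)(u)\<close>: over the rationals, take \<open>A\<close> with basis \<open>x, y, z\<close>, only nonzero
  product \<open>xy = z\<close>, \<open>alpha = diag(2, 1, 2)\<close>, \<open>M\<close> one-dimensional with zero actions, \<open>phi = 2\<close>,
  \<open>T(1) = x\<close>, \<open>a = y\<close>; one gets \<open>z/2\<close> and \<open>z\<close>.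
\<close>
definition bracket_zero ::
    "('a::ab_group_add \<Rightarrow> 'a \<Rightarrow> 'a) \<Rightarrow> ('a \<Rightarrow> 'm::ab_group_add \<Rightarrow> 'm) \<Rightarrow> ('m \<Rightarrow> 'a \<Rightarrow> 'm) \<Rightarrow> ('m \<Rightarrow> 'm) \<Rightarrow>
     nat \<Rightarrow> ('m list \<Rightarrow> 'a) \<Rightarrow> 'a \<Rightarrow> 'm list \<Rightarrow> 'a"
  where "bracket_zero mu l r phi m P a us =
    (\<Sum>i<m. P (map (phi ^^ m) (take i us)
              @ [l a ((phi ^^ (m - 1)) (us ! i)) - r ((phi ^^ (m - 1)) (us ! i)) a]
              @ map (phi ^^ m) (drop (i + 1) us)))
    + mu (P (map (phi ^^ (m - 1)) us)) a - mu a (P (map (phi ^^ (m - 1)) us))"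

text \<open>The operator \<open>d_T\<close> on \<open>n\<close>-cochains, with values regarded as maps of arity \<open>n + 1\<close> on \<open>V\<close>.\<close>
definition d_T ::
    "('k::field \<Rightarrow> 'a::ab_group_add \<Rightarrow> 'a) \<Rightarrow> ('a \<Rightarrow> 'a \<Rightarrow> 'a) \<Rightarrow> ('a \<Rightarrow> 'a) \<Rightarrow>
     ('k \<Rightarrow> 'm::ab_group_add \<Rightarrow> 'm) \<Rightarrow> ('a \<Rightarrow> 'm \<Rightarrow> 'm) \<Rightarrow> ('m \<Rightarrow> 'a \<Rightarrow> 'm) \<Rightarrow> ('m \<Rightarrow> 'm) \<Rightarrow>
     ('m \<Rightarrow> 'a) \<Rightarrow> nat \<Rightarrow> ('m list \<Rightarrow> 'a) \<Rightarrow> ('a \<times> 'm) list \<Rightarrow> 'a \<times> 'm"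
  where "d_T sA mu alpha sM l r phi T n f =
    (let T1 = (\<lambda>us. T (us ! 0)) in
     if n = 0 then ext_AM (bracket_zero mu l r phi 1 T1 (f []))
     else derived_bracket sA mu alpha sM l r phi 1 n T1 f)"

end

theory Submission
  imports Defs
begin

text \<open>
  For \<open>n \<ge> 1\<close> the sign and all terms come out of one observation. The inner bracket
  \<open>[mu + l + r, T]\<close> is the semidirect product on \<open>A \<oplus> M\<close> of the algebra \<open>(M, star_T)\<close> with its
  bimodule \<open>(A, l_T, r_T)\<close> (lemma \<open>bracket_mu_l_r_T\<close>). Bracketing any semidirect product structure
  on \<open>W \<oplus> B\<close> with a cochain \<open>f : B\<^sup>\<otimes>\<^sup>n \<rightarrow> W\<close> gives its Hochschild differential up to the sign
  \<open>(-1)\<^sup>n\<^sup>-\<^sup>1\<close> (lemma \<open>bracket_semidirect_eq_hochschild_d\<close>): inserting \<open>f\<close> into the product leaves only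
  the two outer terms, where an element of \<open>B\<close> acts on a value of \<open>f\<close>, and inserting the product
  into \<open>f\<close> leaves only the product of \<open>B\<close>, which gives the inner terms. The factor \<open>(-1)\<^sup>1\<close> in the
  derived bracket of \<open>T\<close>, which has arity one, turns \<open>(-1)\<^sup>n\<^sup>-\<^sup>1\<close> into \<open>(-1)\<^sup>n\<close>. In degree zero both
  sides are, by definition, the same four terms up to additivity of \<open>T\<close>.
\<close>

lemma funpow_map_prod:
  fixes f :: "'a \<Rightarrow> 'a" and g :: "'b \<Rightarrow> 'b"
  shows "(map_prod f g ^^ k) = map_prod (f ^^ k) (g ^^ k)"
  by (induction k) (auto simp: fun_eq_iff)

text \<open>
  A value \<open>(w, 0)\<close> of the extended \<open>f\<close> multiplies only with the \<open>B\<close>-component of the other factor, so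
  the two insertions of \<open>f\<close> into the product are the outer Hochschild terms. The extended \<open>f\<close>, in turn,
  sees only the \<open>B\<close>-component of a product, so the insertions into \<open>f\<close> are the inner terms.
\<close>
lemma bracket_semidirect_eq_hochschild_d:
  fixes sW :: "'k::field \<Rightarrow> 'w::ab_group_add \<Rightarrow> 'w" and sB :: "'k \<Rightarrow> 'b::ab_group_add \<Rightarrow> 'b"
    and f :: "'b list \<Rightarrow> 'w"
  assumes W: "vector_space sW" and B: "vector_space sB"
    and semidirect: "\<And>x u y v. p [(x, u), (y, v)] = (lB u y + rB x v, star u v)"
    and zeros: "\<And>x. lB 0 x = 0" "\<And>x. rB x 0 = 0" "\<And>u. star 0 u = 0" "\<And>u. star u 0 = 0"
    and "n \<ge> 1" and len: "length vs = n + 1"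
  shows "hom_bracket (\<lambda>c. map_prod (sW c) (sB c)) (map_prod alpha phi) 2 n p (ext_AM f) vs
    = (sW ((- 1) ^ (n - 1)) (hochschild_d sW star phi lB rB n f (map snd vs)), 0)"
proof -
  interpret W: vector_space sW by (rule W)
  interpret B: vector_space sB by (rule B)
  obtain k where k: "n = Suc k" using \<open>n \<ge> 1\<close> by (cases n) auto
  define us where "us = map snd vs"
  let ?s = "\<lambda>c. map_prod (sW c) (sB c)" and ?g = "map_prod alpha phi"
  define L where "L = lB ((phi ^^ k) (us ! 0)) (f (tl us))"
  define R where "R = rB (f (take n us)) ((phi ^^ k) (us ! n))"
  define I where "I = (\<lambda>i. f (map phi (take i us) @ [star (us ! i) (us ! Suc i)] @
    map phi (drop (i + 2) us)))"
  have outer: "circ_prod ?s ?g 2 n p (ext_AM f) vs = (R + sW ((- 1) ^ k) L, 0)"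
  proof -
    have drop_n: "drop n vs = [vs ! n]" using len
      by (metis Cons_nth_drop_Suc add.commute drop_all le_refl lessI plus_1_eq_Suc)
    have take_1: "take (Suc 0) vs = [vs ! 0]" using len
      by (cases vs) auto
    have "(?g ^^ k) w = ((alpha ^^ k) (fst w), (phi ^^ k) (snd w))" for w
      by (cases w) (simp add: funpow_map_prod)
    moreover have "take n (drop (Suc 0) vs) = tl vs"
      using len by (simp add: drop_Suc)
    ultimately show ?thesis
      using len drop_n
      by (simp add: circ_prod_def numeral_2_eq_2 k take_1 semidirect ext_AM_def zeros L_def R_def
          us_def take_map map_tl)
  qed
  have inner: "circ_prod ?s ?g n 2 (ext_AM f) p vs = (\<Sum>i<n. sW ((- 1) ^ i) (I i), 0)"
  proof -
    have "?s ((- 1) ^ i) (ext_AM f (map ?g (take i vs) @ [p (take 2 (drop i vs))] @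
        map ?g (drop (i + 2) vs))) = (sW ((- 1) ^ i) (I i), 0)" if "i < n" for i
    proof -
      have "take 2 (drop i vs) = [vs ! i, vs ! Suc i]"
        using len that by (simp add: numeral_2_eq_2 take_Suc_conv_app_nth)
      moreover have "snd (p [vs ! i, vs ! Suc i]) = star (us ! i) (us ! Suc i)"
        using semidirect[of "fst (vs ! i)" "snd (vs ! i)" "fst (vs ! Suc i)" "snd (vs ! Suc i)"]
          len that by (simp add: us_def)
      ultimately show ?thesis
        by (simp add: ext_AM_def I_def us_def take_map drop_map)
    qed
    then have "circ_prod ?s ?g n 2 (ext_AM f) p vs = (\<Sum>i<n. (sW ((- 1) ^ i) (I i), 0))"
      by (simp add: circ_prod_def)
    also have "\<dots> = (\<Sum>i<n. sW ((- 1) ^ i) (I i), 0)"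
      by (simp add: prod_eq_iff fst_sum snd_sum)
    finally show ?thesis .
  qed
  have hochschild: "hochschild_d sW star phi lB rB n f us =
      L - (\<Sum>i<n. sW ((- 1) ^ i) (I i)) + sW ((- 1) ^ k) R"
  proof -
    have "(\<Sum>i=1..n. sW ((- 1) ^ i) (f (map phi (take (i - 1) us) @
        [star (us ! (i - 1)) (us ! i)] @ map phi (drop (i + 1) us)))) =
      (\<Sum>i<n. sW ((- 1) ^ Suc i) (I i))"
      by (rule sum.reindex_bij_witness[where i = Suc and j = "\<lambda>i. i - 1"]) (auto simp: I_def)
    also have "\<dots> = - (\<Sum>i<n. sW ((- 1) ^ i) (I i))"
      by (simp add: sum_negf)
    finally show ?thesis
      by (simp add: hochschild_d_def k L_def R_def)
  qed
  have "sW ((- 1) ^ k) (sW ((- 1) ^ k) R) = R"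
    by (simp add: power_mult_distrib[symmetric])
  then show ?thesis
    unfolding hom_bracket_def outer inner us_def[symmetric] hochschild
    by (simp add: k W.scale_right_distrib W.scale_right_diff_distrib)
qed

context hom_bimodule
begin

lemma zero_actions:
  "l 0 w = 0" "r w 0 = 0" "mu 0 a = 0" "mu a 0 = 0" "l a 0 = 0" "r 0 a = 0"
  using module_hom.zero l_linear_left r_linear_right mu_linear_left mu_linear_right
    l_linear_right r_linear_left
  unfolding linear_iff_module_hom by blast+

text \<open>
  Inserting \<open>T\<close> into one slot of \<open>mu + l + r\<close> gives the products with a value of \<open>T\<close>, of which those
  landing in \<open>M\<close> form \<open>star_T\<close>; inserting \<open>l + r\<close> into \<open>T\<close> supplies the correction terms of
  \<open>l_T\<close> and \<open>r_T\<close>.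
\<close>
lemma bracket_mu_l_r_T:
  assumes T: "Vector_Spaces.linear sM sA T"
  shows "hom_bracket (\<lambda>c. map_prod (sA c) (sM c)) (map_prod alpha phi) 2 1
      (mu_l_r mu l r) (ext_AM (\<lambda>us. T (us ! 0))) [(x, u), (y, v)]
    = (l_T mu r T u y + r_T mu l T x v, star_T l r T u v)"
proof -
  interpret A: vector_space sA by (rule vector_space_A)
  interpret M: vector_space sM by (rule vector_space_M)
  interpret T: Vector_Spaces.linear sM sA T by (rule T)
  show ?thesis
    by (simp add: zero_actions hom_bracket_def circ_prod_def numeral_2_eq_2 mu_l_r_def ext_AM_def
        l_T_def r_T_def star_T_def T.add)
qed

end

theorem proposition3p5:
  fixes sA :: "'k::field \<Rightarrow> 'a::ab_group_add \<Rightarrow> 'a" and mu :: "'a \<Rightarrow> 'a \<Rightarrow> 'a" and alpha :: "'a \<Rightarrow> 'a"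
    and sM :: "'k \<Rightarrow> 'm::ab_group_add \<Rightarrow> 'm" and l :: "'a \<Rightarrow> 'm \<Rightarrow> 'm" and r :: "'m \<Rightarrow> 'a \<Rightarrow> 'm"
    and phi :: "'m \<Rightarrow> 'm" and T :: "'m \<Rightarrow> 'a"
    and n :: nat and f :: "'m list \<Rightarrow> 'a" and vs :: "('a \<times> 'm) list"
  assumes "regular_hom_assoc_algebra sA mu alpha"
    and "hom_bimodule sA mu alpha sM l r phi" and "bij phi"
    and "O_operator sA mu alpha sM l r phi T"
    and "f \<in> Hom_tensor sM sA n"
    and "length vs = n + 1"
  shows "d_T sA mu alpha sM l r phi T n f vs
    = ext_AM (\<lambda>us. sA ((- 1) ^ n) (d_H sA mu l r phi T n f us)) vs"
proof -
  interpret O_operator sA mu alpha sM l r phi T by fact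
  interpret A: vector_space sA by (rule vector_space_A)
  interpret M: vector_space sM by (rule vector_space_M)
  interpret T: Vector_Spaces.linear sM sA T by (rule T_linear)
  show ?thesis
  proof (cases n)
    case 0
    then show ?thesis
      using \<open>length vs = n + 1\<close>
      by (simp add: d_T_def bracket_zero_def ext_AM_def d_H_def hochschild_d_def l_T_def r_T_def
          T.diff)
  next
    case (Suc k)
    have zeros: "l_T mu r T 0 a = 0" "r_T mu l T a 0 = 0" "star_T l r T 0 w = 0"
        "star_T l r T w 0 = 0" for a w
      by (simp_all add: zero_actions l_T_def r_T_def star_T_def T.zero)
    show ?thesis
      using bracket_semidirect_eq_hochschild_d[where lB = "l_T mu r T" and rB = "r_T mu l T"
          and star = "star_T l r T" and n = n and vs = vs and f = f and alpha = alpha and phi = phi,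
          OF vector_space_A vector_space_M
          bracket_mu_l_r_T[OF T_linear] zeros _ \<open>length vs = n + 1\<close>] Suc
      by (simp add: d_T_def derived_bracket_def Let_def d_H_def ext_AM_def[of _ vs] numeral_2_eq_2)
  qed
qed

end
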